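(* Let $n,k$ be positive integers with $2n\ge k\ge 3$. Then \[\frac{2n-1}{k-1}\ \le\ \rho(C_k,C_{2n})\ \le\ \frac{2n-1-\frac{1}{2n-1}}{k-1-\frac{1}{2n-1}}\ <\ \frac{2n-1}{k-1}+\frac{1}{(k-1)^2}.\]
   Context: $C_\ell$ denotes the cycle with $\ell$ edges. A graphon is a symmetric measurable function $W:[0,1]^2\to[0,1]$. For a finite simple graph $G$ with vertices $v_1,\dots,v_n$, put $t(G,W)=\int_{[0,1]^n}\prod_{v_iv_j\in E(G)}W(x_i,x_j)\,dx_1\cdots dx_n$; for a finite graph $W$ (loops allowed), $t(G,W)=\hom(G,W)/|V(W)|^{|V(G)|}$, where $\hom(G,W)$ is the number of maps $V(G)\to V(W)$ sending edges to edges. For finite simple graphs $G,H$, the density domination exponent is $\rho(G,H)=\sup_W \frac{\log t(H,W)}{\log t(G,W)}\in[0,\infty]$, where $W$ ranges over all graphons (equivalently, all finite graphs) with $t(G,W)\ne 0$. Conventions: those $W$ with $t(G,W)=1$, where the quotient is undefined, are omitted; $\log 0=-\infty$, so the quotient is $+\infty$ if $t(H,W)=0$. Thus, when $G$ has at least one edge, for $c>0$ one has $\rho(G,H)\le c$ if and only if $t(H,W)\ge t(G,W)^c$ for every $W$. *)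

theory Defs
  imports "HOL-Probability.Probability" "Graph_Theory.Pair_Digraph"
begin

text \<open>A finite simple graph is a \<open>pair_graph\<close>: finite, symmetric and loopless. Each undirected
  edge then consists of two opposite arcs.\<close>

definition cycle_graph :: "nat \<Rightarrow> nat pair_pre_digraph" where
  "cycle_graph l =
     \<lparr> pverts = {..<l},
       parcs = {(i, j). i < l \<and> j < l \<and> (j = Suc i mod l \<or> i = Suc j mod l)} \<rparr>"

lemma pair_graph_cycle_graph:
  assumes "l \<ge> 3"
  shows "pair_graph (cycle_graph l)"
proof
  show "finite (parcs (cycle_graph l))"
    by (rule finite_subset[of _ "{..<l} \<times> {..<l}"]) (auto simp: cycle_graph_def)
  show "symmetric (with_proj (cycle_graph l))"
    by (auto simp: symmetric_def sym_def cycle_graph_def)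
  show "fst e \<noteq> snd e" if "e \<in> parcs (cycle_graph l)" for e
    using that assms by (auto simp: cycle_graph_def mod_Suc split: if_splits)
qed (auto simp: cycle_graph_def)

abbreviation unit_interval_measure :: "real measure" where
  "unit_interval_measure \<equiv> restrict_space lborel {0..1}"

text \<open>Measurability is Borel measurability. The values of \<open>W\<close> outside the unit square are irrelevant.\<close>

definition graphon :: "(real \<Rightarrow> real \<Rightarrow> real) \<Rightarrow> bool" where
  "graphon W \<longleftrightarrow>
     (\<lambda>(x, y). W x y) \<in> borel_measurable (unit_interval_measure \<Otimes>\<^sub>M unit_interval_measure) \<and>
     (\<forall>x\<in>{0..1}. \<forall>y\<in>{0..1}. W x y = W y x \<and> 0 \<le> W x y \<and> W x y \<le> 1)"

text \<open>The restriction \<open>u < v\<close> makes every undirected edge occur exactly once in the product; by symmetry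
  of \<open>W\<close> the chosen orientation does not matter.\<close>

definition hom_density ::
    "'a::linorder pair_pre_digraph \<Rightarrow> (real \<Rightarrow> real \<Rightarrow> real) \<Rightarrow> real" where
  "hom_density G W =
     (\<integral>x. (\<Prod>(u, v) | (u, v) \<in> parcs G \<and> u < v. W (x u) (x v))
        \<partial>(\<Pi>\<^sub>M v\<in>pverts G. unit_interval_measure))"

lemma hom_density_bounds:
  assumes "pair_graph G" "graphon W"
  shows "0 \<le> hom_density G W" "hom_density G W \<le> 1"
proof -
  interpret pair_graph G by fact
  have prob: "prob_space unit_interval_measure"
    by (rule prob_spaceI) (simp add: space_restrict_space emeasure_restrict_space)
  interpret Q: prob_space "\<Pi>\<^sub>M v\<in>pverts G. unit_interval_measure"
    by (rule prob_space_PiM) (rule prob)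
  let ?f = "\<lambda>x. \<Prod>(u, v) | (u, v) \<in> parcs G \<and> u < v. W (x u) (x v)"
  have W: "0 \<le> W (x u) (x v) \<and> W (x u) (x v) \<le> 1"
    if "x \<in> space (\<Pi>\<^sub>M v\<in>pverts G. unit_interval_measure)" "(u, v) \<in> parcs G" for x u v
  proof -
    have "u \<in> pverts G" "v \<in> pverts G" using that(2) by (auto dest: in_arcsD1 in_arcsD2)
    then have "x u \<in> {0..1}" "x v \<in> {0..1}"
      using that(1) by (auto simp: space_PiM space_restrict_space PiE_iff)
    then show ?thesis using assms(2) by (auto simp: graphon_def)
  qed
  have f: "0 \<le> ?f x" "?f x \<le> 1" if "x \<in> space (\<Pi>\<^sub>M v\<in>pverts G. unit_interval_measure)" for x
    using W[OF that] by (auto intro!: prod_nonneg prod_le_1)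
  show "0 \<le> hom_density G W"
    unfolding hom_density_def by (rule Bochner_Integration.integral_nonneg) (rule f)
  have "integrable (\<Pi>\<^sub>M v\<in>pverts G. unit_interval_measure) ?f"
  proof (rule Q.integrable_const_bound[of _ 1])
    show "AE x in \<Pi>\<^sub>M v\<in>pverts G. unit_interval_measure. norm (?f x) \<le> 1"
    proof (rule AE_I2)
      fix x assume "x \<in> space (\<Pi>\<^sub>M v\<in>pverts G. unit_interval_measure)"
      from f[OF this] show "norm (?f x) \<le> 1" by (simp only: real_norm_def abs_of_nonneg)
    qed
    show "?f \<in> borel_measurable (\<Pi>\<^sub>M v\<in>pverts G. unit_interval_measure)"
    proof (rule borel_measurable_prod)
      fix e assume "e \<in> {(u, v). (u, v) \<in> parcs G \<and> u < v}"
      then obtain u v where e: "e = (u, v)" "u \<in> pverts G" "v \<in> pverts G"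
        by (auto dest: in_arcsD1 in_arcsD2)
      have *: "(\<lambda>x. (x u, x v)) \<in> (\<Pi>\<^sub>M v\<in>pverts G. unit_interval_measure)
          \<rightarrow>\<^sub>M unit_interval_measure \<Otimes>\<^sub>M unit_interval_measure"
        using e by (intro measurable_Pair measurable_component_singleton)
      have "(\<lambda>(x, y). W x y) \<in> borel_measurable (unit_interval_measure \<Otimes>\<^sub>M unit_interval_measure)"
        using assms(2) by (simp add: graphon_def)
      from measurable_compose[OF * this]
      show "(\<lambda>x. case e of (u, v) \<Rightarrow> W (x u) (x v)) \<in> borel_measurable (\<Pi>\<^sub>M v\<in>pverts G. unit_interval_measure)"
        by (simp add: e)
    qed
  qed
  then have "hom_density G W \<le> (\<integral>x. 1 \<partial>(\<Pi>\<^sub>M v\<in>pverts G. unit_interval_measure))"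
    unfolding hom_density_def by (rule integral_mono) (simp, rule f)
  then show "hom_density G W \<le> 1" by (simp add: Q.prob_space)
qed

text \<open>Both densities lie in the unit interval, so the real quotient below is non-negative and
  \<open>ennreal\<close> does not truncate it. The first case is the convention \<open>log 0 = -\<infinity>\<close>
  (in HOL \<open>ln 0 = 0\<close>); the base of the logarithm cancels.\<close>

definition log_density_ratio ::
    "'a::linorder pair_pre_digraph \<Rightarrow> 'b::linorder pair_pre_digraph \<Rightarrow> (real \<Rightarrow> real \<Rightarrow> real) \<Rightarrow> ennreal" where
  "log_density_ratio G H W =
     (if hom_density H W = 0 then \<infinity>
      else ennreal (ln (hom_density H W) / ln (hom_density G W)))"

text \<open>The supremum is taken in \<open>[0, \<infinity>]\<close>.\<close>

definition domination_exponent ::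
    "'a::linorder pair_pre_digraph \<Rightarrow> 'b::linorder pair_pre_digraph \<Rightarrow> ennreal" where
  "domination_exponent G H =
     (SUP W \<in> {W. graphon W \<and> hom_density G W \<noteq> 0 \<and> hom_density G W \<noteq> 1}.
        log_density_ratio G H W)"

end

theory Submission
  imports Defs
begin

text \<open>Write \<open>S l\<close> for the trace of the \<open>l\<close>-th power of the integral operator of \<open>W\<close>, which is
  \<open>t(C\<^sub>l, W)\<close> for \<open>l \<ge> 3\<close>, and \<open>p\<close> for the edge density.
  Cauchy--Schwarz gives \<open>(S (i + j))\<^sup>2 \<le> S (2i) * S (2j)\<close>, so \<open>ln (S (2i))\<close> is convex in \<open>i\<close> and
  \<open>S k\<close> is bounded by interpolation between \<open>S 2\<close> and \<open>S (2n)\<close>. Here \<open>S 2 \<le> p\<close> since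
  \<open>W \<le> 1\<close>, and \<open>p ^ (2n) \<le> S (2n)\<close> because \<open>S (2n)\<close> dominates the density of walks with \<open>2n\<close>
  edges, which is log-convex in \<open>n\<close> as well. No spectral theorem is needed.
  The lower bound comes from the graphon of two disjoint cliques, where \<open>S l = 2 ^ (1 - l)\<close>.\<close>

section \<open>Powers of a symmetric kernel and their traces\<close>

locale symmetric_kernel = prob_space M for M :: "'a measure" +
  fixes w :: "'a \<Rightarrow> 'a \<Rightarrow> ennreal"
  assumes kernel_measurable: "case_prod w \<in> borel_measurable (M \<Otimes>\<^sub>M M)"
    and kernel_sym: "x \<in> space M \<Longrightarrow> y \<in> space M \<Longrightarrow> w x y = w y x"
    and kernel_le_1: "x \<in> space M \<Longrightarrow> y \<in> space M \<Longrightarrow> w x y \<le> 1"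
begin

sublocale MM: pair_sigma_finite M M ..

lemma w_measurable[measurable]:
  assumes "f \<in> N \<rightarrow>\<^sub>M M" "g \<in> N \<rightarrow>\<^sub>M M"
  shows "(\<lambda>z. w (f z) (g z)) \<in> borel_measurable N"
  using measurable_compose[OF measurable_Pair[OF assms] kernel_measurable] by simp

text \<open>The index is shifted by one: \<open>kpow j\<close> is the kernel of the operator power of exponent
  \<open>j + 1\<close>, and \<open>tr j\<close> belongs to the cycle of length \<open>j + 1\<close>.\<close>

primrec kpow :: "nat \<Rightarrow> 'a \<Rightarrow> 'a \<Rightarrow> ennreal" where
  "kpow 0 x y = w x y"
| "kpow (Suc j) x y = (\<integral>\<^sup>+z. kpow j x z * w z y \<partial>M)"

definition tr :: "nat \<Rightarrow> ennreal" where
  "tr j = (\<integral>\<^sup>+x. kpow j x x \<partial>M)"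

lemma kpow_measurable[measurable]:
  assumes "f \<in> N \<rightarrow>\<^sub>M M" "g \<in> N \<rightarrow>\<^sub>M M"
  shows "(\<lambda>z. kpow j (f z) (g z)) \<in> borel_measurable N"
proof -
  have "case_prod (kpow j) \<in> borel_measurable (M \<Otimes>\<^sub>M M)"
  proof (induction j)
    case 0
    then show ?case by simp
  next
    case (Suc j)
    have [measurable]: "(\<lambda>q. kpow j (fst (fst q)) (snd q)) \<in> borel_measurable ((M \<Otimes>\<^sub>M M) \<Otimes>\<^sub>M M)"
      using measurable_compose[OF _ Suc, of "\<lambda>q. (fst (fst q), snd q)" "(M \<Otimes>\<^sub>M M) \<Otimes>\<^sub>M M"] by simp
    have "(\<lambda>p. \<integral>\<^sup>+z. kpow j (fst p) z * w z (snd p) \<partial>M) \<in> borel_measurable (M \<Otimes>\<^sub>M M)"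
      by (rule borel_measurable_nn_integral) (simp add: case_prod_beta')
    then show ?case by (simp add: case_prod_beta')
  qed
  from measurable_compose[OF measurable_Pair[OF assms] this] show ?thesis by simp
qed

text \<open>Associativity of operator composition, by Tonelli. The exponents \<open>i + 1\<close>
  and \<open>j + 1\<close> add up to \<open>i + j + 2\<close>, whose shifted index is
  \<open>Suc (i + j)\<close>.\<close>

lemma kpow_comp:
  assumes [measurable]: "x \<in> space M" "y \<in> space M"
  shows "kpow (Suc (i + j)) x y = (\<integral>\<^sup>+z. kpow i x z * kpow j z y \<partial>M)"
  using assms(2)
proof (induction j arbitrary: y)
  case 0
  then show ?case by simp
next
  case (Suc j)
  note [measurable] = Suc.prems
  have "kpow (Suc (i + Suc j)) x y = (\<integral>\<^sup>+u. kpow (Suc (i + j)) x u * w u y \<partial>M)"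
    by simp
  also have "\<dots> = (\<integral>\<^sup>+u. (\<integral>\<^sup>+z. kpow i x z * kpow j z u \<partial>M) * w u y \<partial>M)"
    by (intro nn_integral_cong) (simp only: Suc.IH)
  also have "\<dots> = (\<integral>\<^sup>+u. (\<integral>\<^sup>+z. kpow i x z * (kpow j z u * w u y) \<partial>M) \<partial>M)"
    by (intro nn_integral_cong) (simp add: nn_integral_multc[symmetric] mult.assoc)
  also have "\<dots> = (\<integral>\<^sup>+z. (\<integral>\<^sup>+u. kpow i x z * (kpow j z u * w u y) \<partial>M) \<partial>M)"
    by (rule MM.Fubini') measurable
  also have "\<dots> = (\<integral>\<^sup>+z. kpow i x z * kpow (Suc j) z y \<partial>M)"
    by (intro nn_integral_cong) (simp add: nn_integral_cmult)
  finally show ?case .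
qed

text \<open>Reversing a walk moves its last factor to the front; \<open>kpow_comp\<close> with first
  index 0 reassembles the product from that end.\<close>

lemma kpow_sym:
  assumes "x \<in> space M" "y \<in> space M"
  shows "kpow j x y = kpow j y x"
  using assms
proof (induction j arbitrary: x y)
  case 0
  then show ?case by (simp add: kernel_sym)
next
  case (Suc j)
  have "kpow (Suc j) x y = (\<integral>\<^sup>+z. kpow 0 y z * kpow j z x \<partial>M)"
    unfolding kpow.simps
    using Suc by (intro nn_integral_cong) (metis kernel_sym mult.commute)
  also have "\<dots> = kpow (Suc j) y x"
    using kpow_comp[OF Suc.prems(2,1), of 0 j] by simp
  finally show ?case .
qed

lemma kpow_le_1:
  assumes "x \<in> space M" "y \<in> space M"
  shows "kpow j x y \<le> 1"
  using assms
proof (induction j arbitrary: y)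
  case 0
  then show ?case by (simp add: kernel_le_1)
next
  case (Suc j)
  have "kpow (Suc j) x y \<le> (\<integral>\<^sup>+z. 1 \<partial>M)"
    unfolding kpow.simps
    using Suc kernel_le_1 by (intro nn_integral_mono) (metis mult_mono mult_1 zero_le)
  then show ?case by (simp add: emeasure_space_1)
qed

lemma tr_le_1: "tr j \<le> 1"
proof -
  have "tr j \<le> (\<integral>\<^sup>+x. 1 \<partial>M)"
    unfolding tr_def by (intro nn_integral_mono) (simp add: kpow_le_1)
  then show ?thesis by (simp add: emeasure_space_1)
qed

text \<open>By symmetry the trace of a product of two powers is the Hilbert--Schmidt inner product
  of their kernels, the form to which Cauchy--Schwarz applies.\<close>

lemma tr_add: "tr (Suc (i + j)) = (\<integral>\<^sup>+x. \<integral>\<^sup>+y. kpow i x y * kpow j x y \<partial>M \<partial>M)"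
  unfolding tr_def
proof (intro nn_integral_cong)
  fix x assume x: "x \<in> space M"
  have "(\<integral>\<^sup>+y. kpow i x y * kpow j y x \<partial>M) = (\<integral>\<^sup>+y. kpow i x y * kpow j x y \<partial>M)"
    by (intro nn_integral_cong) (simp only: kpow_sym[OF x, of _ j])
  then show "kpow (Suc (i + j)) x x = \<dots>" by (simp only: kpow_comp[OF x x])
qed

text \<open>Cauchy--Schwarz on the product space; the cycle lengths involved are
  \<open>i + j + 2\<close>, \<open>2 * i + 2\<close> and \<open>2 * j + 2\<close>.\<close>

lemma tr_power2_le: "(tr (Suc (i + j)))\<^sup>2 \<le> tr (Suc (2 * i)) * tr (Suc (2 * j))"
proof -
  have *: "tr (Suc (a + b)) = (\<integral>\<^sup>+z. kpow a (fst z) (snd z) * kpow b (fst z) (snd z) \<partial>(M \<Otimes>\<^sub>M M))" for a b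
    unfolding tr_add by (subst nn_integral_fst[symmetric]) simp_all
  have "(\<integral>\<^sup>+z. kpow i (fst z) (snd z) * kpow j (fst z) (snd z) \<partial>(M \<Otimes>\<^sub>M M))\<^sup>2
      \<le> (\<integral>\<^sup>+z. (kpow i (fst z) (snd z))\<^sup>2 \<partial>(M \<Otimes>\<^sub>M M)) * (\<integral>\<^sup>+z. (kpow j (fst z) (snd z))\<^sup>2 \<partial>(M \<Otimes>\<^sub>M M))"
    by (rule Cauchy_Schwarz_nn_integral) measurable
  then show ?thesis unfolding mult_2 * by (simp only: power2_eq_square)
qed

section \<open>Edge density and walk densities\<close>

definition edge :: ennreal where
  "edge = (\<integral>\<^sup>+x. \<integral>\<^sup>+y. w x y \<partial>M \<partial>M)"

lemma tr_1_le_edge: "tr 1 \<le> edge"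
proof -
  have "w x y * w x y \<le> w x y" if "x \<in> space M" "y \<in> space M" for x y
    using kernel_le_1[OF that] by (metis mult_left_mono mult.right_neutral zero_le)
  then show ?thesis
    using tr_add[of 0 0] unfolding edge_def by (auto intro!: nn_integral_mono)
qed

text \<open>The operator applied \<open>j\<close> times to the constant 1. Unlike in
  \<open>kpow\<close>, the index is not shifted: it counts edges.\<close>

primrec walks :: "nat \<Rightarrow> 'a \<Rightarrow> ennreal" where
  "walks 0 x = 1"
| "walks (Suc j) x = (\<integral>\<^sup>+z. w x z * walks j z \<partial>M)"

definition path_density :: "nat \<Rightarrow> ennreal" where
  "path_density j = (\<integral>\<^sup>+x. walks j x \<partial>M)"

lemma walks_measurable[measurable]: "walks j \<in> borel_measurable M"
proof (induction j)
  case (Suc j)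
  note [measurable] = Suc
  have "(\<lambda>x. \<integral>\<^sup>+z. w x z * walks j z \<partial>M) \<in> borel_measurable M" by measurable
  then show ?case by (simp cong: measurable_cong)
qed simp

text \<open>Self-adjointness of the operator, from Tonelli and the symmetry of
  \<open>w\<close>.\<close>

lemma walks_shift:
  "(\<integral>\<^sup>+x. walks (Suc i) x * walks j x \<partial>M) = (\<integral>\<^sup>+x. walks i x * walks (Suc j) x \<partial>M)"
proof -
  have "(\<integral>\<^sup>+x. walks (Suc i) x * walks j x \<partial>M) = (\<integral>\<^sup>+x. \<integral>\<^sup>+z. w x z * walks i z * walks j x \<partial>M \<partial>M)"
    by (intro nn_integral_cong) (simp add: nn_integral_multc)
  also have "\<dots> = (\<integral>\<^sup>+z. \<integral>\<^sup>+x. w x z * walks i z * walks j x \<partial>M \<partial>M)"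
    by (rule MM.Fubini'[symmetric]) measurable
  also have "\<dots> = (\<integral>\<^sup>+z. \<integral>\<^sup>+x. walks i z * (w z x * walks j x) \<partial>M \<partial>M)"
    by (intro nn_integral_cong) (simp only: kernel_sym mult_ac)
  also have "\<dots> = (\<integral>\<^sup>+z. walks i z * walks (Suc j) z \<partial>M)"
    by (intro nn_integral_cong) (simp add: nn_integral_cmult)
  finally show ?thesis .
qed

text \<open>A walk is cut at an inner vertex; \<open>walks_shift\<close> moves the cut one edge at a
  time, starting from an end of the walk.\<close>

lemma path_density_add: "path_density (i + j) = (\<integral>\<^sup>+x. walks i x * walks j x \<partial>M)"
proof (induction j arbitrary: i)
  case 0
  then show ?case by (simp add: path_density_def)
next
  case (Suc j)
  show ?case
    using Suc[of "Suc i"] walks_shift[of i j] by (simp only: add_Suc add_Suc_right)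
qed

lemma path_density_power2_le:
  "(path_density (i + j))\<^sup>2 \<le> path_density (2 * i) * path_density (2 * j)"
  unfolding path_density_add mult_2
  using Cauchy_Schwarz_nn_integral[OF walks_measurable walks_measurable, of i j]
  by (simp only: power2_eq_square)

lemma path_density_0: "path_density 0 = 1"
  by (simp add: path_density_def emeasure_space_1)

lemma path_density_1: "path_density 1 = edge"
  by (simp add: path_density_def edge_def)

lemma walks_le_1: "x \<in> space M \<Longrightarrow> walks j x \<le> 1"
proof (induction j arbitrary: x)
  case (Suc j)
  have "walks (Suc j) x \<le> (\<integral>\<^sup>+z. 1 \<partial>M)"
    unfolding walks.simps
    using Suc kernel_le_1 by (intro nn_integral_mono) (metis mult_mono mult_1 zero_le)
  then show ?case by (simp add: emeasure_space_1)
qed simp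

lemma path_density_le_1: "path_density j \<le> 1"
proof -
  have "path_density j \<le> (\<integral>\<^sup>+x. 1 \<partial>M)"
    unfolding path_density_def by (intro nn_integral_mono) (simp add: walks_le_1)
  then show ?thesis by (simp add: emeasure_space_1)
qed

text \<open>Links walks to kernels. \<open>walks\<close> peels off the first edge and
  \<open>kpow\<close> the last, so \<open>kpow_comp\<close> with index 0 is needed to match
  them.\<close>

lemma walks_Suc_eq: "x \<in> space M \<Longrightarrow> walks (Suc j) x = (\<integral>\<^sup>+y. kpow j x y \<partial>M)"
proof (induction j arbitrary: x)
  case (Suc j)
  note [measurable] = Suc.prems
  have "walks (Suc (Suc j)) x = (\<integral>\<^sup>+z. w x z * (\<integral>\<^sup>+y. kpow j z y \<partial>M) \<partial>M)"
    by (subst walks.simps) (intro nn_integral_cong, simp only: Suc.IH)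
  also have "\<dots> = (\<integral>\<^sup>+z. \<integral>\<^sup>+y. w x z * kpow j z y \<partial>M \<partial>M)"
    by (intro nn_integral_cong) (simp add: nn_integral_cmult)
  also have "\<dots> = (\<integral>\<^sup>+y. \<integral>\<^sup>+z. w x z * kpow j z y \<partial>M \<partial>M)"
    by (rule MM.Fubini'[symmetric]) measurable
  also have "\<dots> = (\<integral>\<^sup>+y. kpow (Suc j) x y \<partial>M)"
    using kpow_comp[OF Suc.prems, of _ 0 j] by (intro nn_integral_cong) simp
  finally show ?case .
next
  case 0
  show ?case by (simp only: walks.simps kpow.simps mult_1_right)
qed

text \<open>For fixed \<open>x\<close>, Cauchy--Schwarz against the constant 1 bounds the squared
  row integral of \<open>kpow j\<close> by the row integral of its square. Integrating over
  \<open>x\<close> compares walks with \<open>2 * j + 2\<close> edges to cycles of that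
  length.\<close>

lemma path_density_le_tr: "path_density (2 * Suc j) \<le> tr (Suc (2 * j))"
proof -
  have "(walks (Suc j) x)\<^sup>2 \<le> (\<integral>\<^sup>+y. kpow j x y * kpow j x y \<partial>M)" if [measurable]: "x \<in> space M" for x
    unfolding walks_Suc_eq[OF that]
    using Cauchy_Schwarz_nn_integral[of "\<lambda>y. kpow j x y" M "\<lambda>_. 1"]
    by (simp add: emeasure_space_1 power2_eq_square)
  then show ?thesis
    unfolding mult_2 path_density_add tr_add
    by (intro nn_integral_mono) (simp add: power2_eq_square)
qed

text \<open>The factor \<open>kpow j\<close> stands for \<open>j + 1\<close> edges of the cycle
  whose inner vertices are already integrated out. Integrating the last remaining vertex absorbs one
  more edge into it, hence the induction with \<open>j\<close> arbitrary; \<open>j = 0\<close> is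
  the plain cycle.\<close>

lemma nn_integral_cycle:
  "(\<integral>\<^sup>+x. (\<Prod>i<l. w (x i) (x (Suc i))) * kpow j (x 0) (x l) \<partial>(\<Pi>\<^sub>M i\<in>{..<Suc l}. M)) = tr (l + j)"
proof (induction l arbitrary: j)
  case 0
  interpret product_sigma_finite "\<lambda>_. M" ..
  have "{..<Suc 0} = {0::nat}" by auto
  then show ?case
    using product_nn_integral_singleton[of "\<lambda>z. kpow j z z" 0] by (simp add: tr_def)
next
  case (Suc l)
  interpret product_sigma_finite "\<lambda>_. M" ..
  let ?g = "\<lambda>x :: nat \<Rightarrow> 'a. (\<Prod>i<Suc l. w (x i) (x (Suc i))) * kpow j (x 0) (x (Suc l))"
  have "integral\<^sup>N (\<Pi>\<^sub>M i\<in>{..<Suc (Suc l)}. M) ?g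
      = (\<integral>\<^sup>+x. \<integral>\<^sup>+y. ?g (x(Suc l := y)) \<partial>M \<partial>(\<Pi>\<^sub>M i\<in>{..<Suc l}. M))"
    unfolding lessThan_Suc[of "Suc l"]
    by (rule product_nn_integral_insert) (simp_all add: lessThan_Suc[symmetric] del: prod.lessThan_Suc, measurable)
  also have "\<dots> = (\<integral>\<^sup>+x. (\<Prod>i<l. w (x i) (x (Suc i))) * kpow (Suc j) (x 0) (x l) \<partial>(\<Pi>\<^sub>M i\<in>{..<Suc l}. M))"
  proof (intro nn_integral_cong)
    fix x assume "x \<in> space (\<Pi>\<^sub>M i\<in>{..<Suc l}. M)"
    then have x: "x \<in> {..<Suc l} \<rightarrow>\<^sub>E space M" by (simp only: space_PiM)
    have [measurable]: "x 0 \<in> space M" and xl [measurable]: "x l \<in> space M"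
      by (rule PiE_mem[OF x]; simp)+
    have "(\<integral>\<^sup>+y. ?g (x(Suc l := y)) \<partial>M)
        = (\<integral>\<^sup>+y. (\<Prod>i<l. w (x i) (x (Suc i))) * (kpow j (x 0) y * w y (x l)) \<partial>M)"
      by (intro nn_integral_cong) (simp add: kernel_sym[OF xl] mult_ac)
    also have "\<dots> = (\<Prod>i<l. w (x i) (x (Suc i))) * kpow (Suc j) (x 0) (x l)"
      by (simp add: nn_integral_cmult)
    finally show "(\<integral>\<^sup>+y. ?g (x(Suc l := y)) \<partial>M) = \<dots>" .
  qed
  also have "\<dots> = tr (Suc l + j)" using Suc.IH[of "Suc j"] by simp
  finally show ?case .
qed

end

section \<open>Discrete convexity and the passage from \<open>ennreal\<close> to reals\<close>

lemma discrete_convex_chord: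
  fixes f :: "nat \<Rightarrow> real"
  assumes convex: "\<And>i. i + 2 \<le> n \<Longrightarrow> 2 * f (i + 1) \<le> f i + f (i + 2)" and "i \<le> n"
  shows "real n * f i \<le> (real n - real i) * f 0 + real i * f n"
proof -
  have mono: "f (Suc a) - f a \<le> f (Suc b) - f b" if "a \<le> b" "Suc b \<le> n" for a b
    using that
  proof (induction b rule: dec_induct)
    case (step b)
    then show ?case using convex[of b] by simp
  qed simp
  show ?thesis
  proof (cases "i = n")
    case False
    with \<open>i \<le> n\<close> have "i < n" by simp
    \<comment> \<open>The slope just after \<open>i\<close> bounds all earlier slopes from above and
      all later ones from below.\<close>
    define d where "d = f (Suc i) - f i"
    have "f i - f 0 = (\<Sum>j<i. f (Suc j) - f j)"
      by (simp add: sum_lessThan_telescope)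
    also have "\<dots> \<le> (\<Sum>j<i. d)"
      unfolding d_def using \<open>i < n\<close> by (intro sum_mono mono) auto
    finally have 1: "f i - f 0 \<le> real i * d" by simp
    have "(real n - real i) * d = (\<Sum>j=i..<n. d)"
      using \<open>i \<le> n\<close> by (simp add: of_nat_diff)
    also have "\<dots> \<le> (\<Sum>j=i..<n. f (Suc j) - f j)"
      unfolding d_def by (intro sum_mono mono) auto
    also have "\<dots> = f n - f i"
      using \<open>i \<le> n\<close> by (simp add: sum_Suc_diff')
    finally have 2: "(real n - real i) * d \<le> f n - f i" .
    have "(real n - real i) * (f i - f 0) \<le> (real n - real i) * (real i * d)"
      using 1 \<open>i \<le> n\<close> by (intro mult_left_mono) auto
    also have "\<dots> = real i * ((real n - real i) * d)" by simp
    also have "\<dots> \<le> real i * (f n - f i)"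
      using 2 by (intro mult_left_mono) auto
    finally show ?thesis by (simp add: algebra_simps)
  qed simp
qed

text \<open>The bounds by 1 keep the right-hand side away from infinity, which
  \<open>enn2real\<close> sends to 0.\<close>

lemma enn2real_power2_le:
  fixes x y z :: ennreal
  assumes "x\<^sup>2 \<le> y * z" "y \<le> 1" "z \<le> 1"
  shows "(enn2real x)\<^sup>2 \<le> enn2real y * enn2real z"
proof -
  have "y * z < \<top>"
    using assms(2,3) by (auto simp: ennreal_mult_less_top intro: le_less_trans)
  then show ?thesis
    using enn2real_mono[OF assms(1)] by (simp add: enn2real_mult power2_eq_square)
qed

lemma enn2real_pos_iff: "x \<le> 1 \<Longrightarrow> 0 < enn2real x \<longleftrightarrow> x \<noteq> (0::ennreal)"
  by (auto simp: enn2real_positive_iff zero_less_iff_neq_zero intro: le_less_trans)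

section \<open>Logarithmic inequalities between traces and the edge density\<close>

context symmetric_kernel
begin

lemma edge_le_1: "edge \<le> 1"
  using path_density_le_1[of 1] path_density_1 by simp

text \<open>If \<open>edge\<close> vanishes, so does \<open>tr 1\<close>, and Cauchy--Schwarz with
  first index 0 then kills every \<open>tr (Suc j)\<close>.\<close>

lemma edge_pos:
  assumes "tr (Suc j) \<noteq> 0"
  shows "edge \<noteq> 0"
proof
  assume "edge = 0"
  then have "tr 1 = 0" using tr_1_le_edge by simp
  then show False using tr_power2_le[of 0 j] assms by simp
qed

text \<open>Cauchy--Schwarz with indices \<open>i\<close> and \<open>i + 2\<close> carries
  positivity from \<open>2 * (i + 1)\<close> edges to \<open>2 * (i + 2)\<close>. Positivity matters
  because \<open>ln 0 = 0\<close> in HOL.\<close>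

lemma path_density_pos:
  assumes "edge \<noteq> 0"
  shows "path_density (2 * i) \<noteq> 0"
proof -
  have "path_density (2 * i) \<noteq> 0 \<and> path_density (2 * Suc i) \<noteq> 0"
  proof (induction i)
    case 0
    have "edge\<^sup>2 \<le> path_density 2"
      using path_density_power2_le[of 0 1] by (simp add: path_density_0 path_density_1[symmetric])
    with assms show ?case by (auto simp: path_density_0 numeral_2_eq_2)
  next
    case (Suc i)
    have *: "i + Suc (Suc i) = 2 * Suc i" by simp
    show ?case
      using Suc path_density_power2_le[of i "Suc (Suc i)", unfolded *] by (auto simp del: mult_Suc_right)
  qed
  then show ?thesis ..
qed

text \<open>The log-densities of even walks form a convex sequence starting at 0, so its value at
  \<open>n\<close> is at least \<open>n\<close> times its value at 1, which is at least
  \<open>2 * ln p\<close>.\<close>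

lemma path_density_ge:
  assumes "edge \<noteq> 0"
  shows "real (2 * n) * ln (enn2real edge) \<le> ln (enn2real (path_density (2 * n)))"
proof (cases "n = 0")
  case False
  define f where "f i = ln (enn2real (path_density (2 * i)))" for i
  have pos: "0 < enn2real (path_density (2 * i))" for i
    using path_density_pos[OF assms] by (simp add: enn2real_pos_iff path_density_le_1)
  have e: "0 < enn2real edge" using assms by (simp add: enn2real_pos_iff edge_le_1)
  have "2 * f (i + 1) \<le> f i + f (i + 2)" for i
  proof -
    have *: "i + (i + 2) = 2 * (i + 1)" by simp
    have "(enn2real (path_density (2 * (i + 1))))\<^sup>2
        \<le> enn2real (path_density (2 * i)) * enn2real (path_density (2 * (i + 2)))"
      using path_density_power2_le[of i "i + 2"] unfolding *
      by (intro enn2real_power2_le path_density_le_1)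
    then have "ln ((enn2real (path_density (2 * (i + 1))))\<^sup>2)
        \<le> ln (enn2real (path_density (2 * i)) * enn2real (path_density (2 * (i + 2))))"
      using pos[of i] pos[of "i + 2"] pos[of "i + 1"] by (subst ln_le_cancel_iff) auto
    then show ?thesis
      unfolding f_def using pos[of i] pos[of "i + 2"] pos[of "i + 1"]
      by (simp add: ln_mult ln_realpow)
  qed
  then have "real n * f 1 \<le> (real n - real 1) * f 0 + real 1 * f n"
    using False by (intro discrete_convex_chord) auto
  moreover have "f 0 = 0" by (simp add: f_def path_density_0)
  moreover have "2 * ln (enn2real edge) \<le> f 1"
  proof -
    have "(enn2real edge)\<^sup>2 \<le> enn2real (path_density 0) * enn2real (path_density 2)"
      using path_density_power2_le[of 0 1]
      by (intro enn2real_power2_le path_density_le_1) (simp add: path_density_1[symmetric])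
    then have "ln ((enn2real edge)\<^sup>2) \<le> ln (enn2real (path_density 2))"
      using e pos[of 1] by (subst ln_le_cancel_iff) (auto simp: path_density_0)
    then show ?thesis using e by (simp add: f_def ln_realpow)
  qed
  ultimately show ?thesis
    using mult_left_mono[of "2 * ln (enn2real edge)" "f 1" "real n"] by (simp add: f_def)
qed (simp add: path_density_0)

text \<open>The Sidorenko bound for even cycles in logarithmic form, inherited from walks.\<close>

lemma tr_ge:
  assumes "edge \<noteq> 0"
  shows "real (2 * Suc j) * ln (enn2real edge) \<le> ln (enn2real (tr (Suc (2 * j))))"
    and "tr (Suc (2 * j)) \<noteq> 0"
proof -
  have *: "path_density (2 * Suc j) \<noteq> 0" by (rule path_density_pos[OF assms])
  with path_density_le_tr[of j] show t: "tr (Suc (2 * j)) \<noteq> 0" by auto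
  have "enn2real (path_density (2 * Suc j)) \<le> enn2real (tr (Suc (2 * j)))"
    using tr_le_1[of "Suc (2 * j)"] by (intro enn2real_mono path_density_le_tr) (auto intro: le_less_trans)
  then have "ln (enn2real (path_density (2 * Suc j))) \<le> ln (enn2real (tr (Suc (2 * j))))"
    using * t by (subst ln_le_cancel_iff) (auto simp: enn2real_pos_iff path_density_le_1 tr_le_1 simp del: mult_Suc_right)
  with path_density_ge[OF assms, of "Suc j"]
  show "real (2 * Suc j) * ln (enn2real edge) \<le> ln (enn2real (tr (Suc (2 * j))))" by linarith
qed

text \<open>The core of the upper bound. With \<open>m = 2n - 1\<close> and \<open>K = k - 1\<close>
  the two coefficients are \<open>m^2 - 1\<close> and \<open>m * K - 1\<close>.\<close>

lemma ln_tr_le: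
  assumes nz: "tr (k - 1) \<noteq> 0" and k: "3 \<le> k" "k \<le> 2 * n"
  shows "tr (2 * n - 1) \<noteq> 0"
    and "real (4 * n) * (real n - 1) * ln (enn2real (tr (k - 1)))
      \<le> (2 * real n * (real k - 1) - real k) * ln (enn2real (tr (2 * n - 1)))"
proof -
  \<comment> \<open>\<open>f i\<close> belongs to length \<open>2 * i + 2\<close>:
    \<open>f 0\<close> to length 2 and, with \<open>N = n - 1\<close>, \<open>f N\<close> to length
    \<open>2 * n\<close>.\<close>
  define f where "f i = ln (enn2real (tr (Suc (2 * i))))" for i
  from k obtain N where n: "n = Suc N" "N > 0" by (cases n; cases "n - 1") auto
  have e: "edge \<noteq> 0" using edge_pos[of "k - 2"] nz k by (auto simp: numeral_2_eq_2 Suc_diff_Suc)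
  have N: "Suc (2 * N) = 2 * n - 1" using n by simp
  from tr_ge(2)[OF e, of N] show "tr (2 * n - 1) \<noteq> 0" unfolding N .
  have pos: "0 < enn2real (tr (Suc (2 * i)))" for i
    using tr_ge(2)[OF e] by (simp add: enn2real_pos_iff tr_le_1)
  have cs: "2 * ln (enn2real (tr (Suc (i + j)))) \<le> f i + f j" if "tr (Suc (i + j)) \<noteq> 0" for i j
  proof -
    have p: "0 < enn2real (tr (Suc (i + j)))"
      using that by (simp add: enn2real_pos_iff tr_le_1)
    have "(enn2real (tr (Suc (i + j))))\<^sup>2
        \<le> enn2real (tr (Suc (2 * i))) * enn2real (tr (Suc (2 * j)))"
      by (intro enn2real_power2_le tr_le_1 tr_power2_le)
    then have "ln ((enn2real (tr (Suc (i + j))))\<^sup>2)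
        \<le> ln (enn2real (tr (Suc (2 * i))) * enn2real (tr (Suc (2 * j))))"
      using pos[of i] pos[of j] p by (subst ln_le_cancel_iff) auto
    then show ?thesis
      unfolding f_def using pos[of i] pos[of j] p by (simp add: ln_mult ln_realpow)
  qed
  have convex: "2 * f (i + 1) \<le> f i + f (i + 2)" for i
  proof -
    have *: "Suc (i + (i + 2)) = Suc (2 * (i + 1))" by simp
    show ?thesis
      using cs[of i "i + 2", unfolded *, OF tr_ge(2)[OF e]] unfolding f_def .
  qed
  \<comment> \<open>Splitting \<open>k - 2\<close> as evenly as possible treats odd \<open>k\<close>
    too; \<open>k \<le> 2 * n\<close> keeps both halves within \<open>N\<close>.\<close>
  define i where "i = k div 2 - 1"
  define j where "j = k - 2 - i"
  have ij: "Suc (i + j) = k - 1" "i \<le> N" "j \<le> N" "real i + real j = real k - 2"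
    using k n unfolding i_def j_def by auto
  have chord: "real N * f a \<le> (real N - real a) * f 0 + real a * f N" if "a \<le> N" for a
    using that by (intro discrete_convex_chord convex)
  have f0: "f 0 \<le> ln (enn2real edge)"
  proof -
    have "enn2real (tr 1) \<le> enn2real edge"
      using edge_le_1 by (intro enn2real_mono tr_1_le_edge) (auto intro: le_less_trans)
    then show ?thesis
      unfolding f_def using pos[of 0] e
      by (subst ln_le_cancel_iff) (auto simp: enn2real_pos_iff edge_le_1)
  qed
  have fN: "2 * real n * f 0 \<le> f N"
    using tr_ge(1)[OF e, of N] mult_left_mono[OF f0, of "2 * real n"] n by (simp add: f_def[of N] distrib_right)
  let ?t = "ln (enn2real (tr (k - 1)))"
  have "2 * ?t \<le> f i + f j" using cs[of i j] nz ij(1) by simp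
  then have "real N * (2 * ?t) \<le> real N * (f i + f j)" by (intro mult_left_mono) auto
  also have "\<dots> \<le> (2 * real N - (real i + real j)) * f 0 + (real i + real j) * f N"
    using chord[OF ij(2)] chord[OF ij(3)] by (simp add: algebra_simps)
  finally have "2 * real n * (real N * (2 * ?t))
      \<le> 2 * real n * ((2 * real N - (real k - 2)) * f 0 + (real k - 2) * f N)"
    unfolding ij(4) by (intro mult_left_mono) auto
  also have "\<dots> = (2 * real n - real k) * (2 * real n * f 0) + 2 * real n * (real k - 2) * f N"
    using n by (simp add: algebra_simps)
  \<comment> \<open>The coefficient \<open>2 * n - k\<close> is non-negative, so the length-2 term
    may be replaced through \<open>fN\<close>.\<close>
  also have "\<dots> \<le> (2 * real n - real k) * f N + 2 * real n * (real k - 2) * f N"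
    using k by (intro add_right_mono mult_left_mono fN) auto
  also have "\<dots> = (2 * real n * (real k - 1) - real k) * f N" by (simp add: algebra_simps)
  finally show "real (4 * n) * (real n - 1) * ?t
      \<le> (2 * real n * (real k - 1) - real k) * ln (enn2real (tr (2 * n - 1)))"
    using n unfolding N[symmetric] f_def[symmetric] by (simp add: algebra_simps)
qed

end

section \<open>Cycle densities of graphons as traces\<close>

lemma prob_space_unit_interval: "prob_space unit_interval_measure"
  by (rule prob_spaceI) (simp add: space_restrict_space emeasure_restrict_space)

lemma symmetric_kernel_graphon:
  assumes "graphon W"
  shows "symmetric_kernel unit_interval_measure (\<lambda>x y. ennreal (W x y))"
proof -
  interpret prob_space unit_interval_measure by (rule prob_space_unit_interval)
  show ?thesis
  proof
    have "(\<lambda>z. ennreal (case_prod W z)) \<in> borel_measurable (unit_interval_measure \<Otimes>\<^sub>M unit_interval_measure)"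
      using assms by (intro measurable_compose[OF _ measurable_ennreal]) (simp add: graphon_def)
    then show "(\<lambda>(x, y). ennreal (W x y)) \<in> borel_measurable (unit_interval_measure \<Otimes>\<^sub>M unit_interval_measure)"
      by (simp add: case_prod_beta')
  qed (use assms in \<open>auto simp: graphon_def space_restrict_space\<close>)
qed

text \<open>Orienting edges by \<open>u < v\<close> turns the wrap-around edge into
  \<open>(0, l - 1)\<close>; the others form a path.\<close>

lemma cycle_graph_edges:
  assumes "l \<ge> 3"
  shows "{(u, v). (u, v) \<in> parcs (cycle_graph l) \<and> u < v} = insert (0, l - 1) ((\<lambda>i. (i, Suc i)) ` {..<l - 1})"
  using assms by (auto simp: cycle_graph_def mod_Suc image_iff split: if_splits)

lemma hom_density_cycle:
  assumes W: "graphon W" and l: "l \<ge> 3"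
  shows "ennreal (hom_density (cycle_graph l) W)
    = symmetric_kernel.tr unit_interval_measure (\<lambda>x y. ennreal (W x y)) (l - 1)"
proof -
  interpret symmetric_kernel unit_interval_measure "\<lambda>x y. ennreal (W x y)"
    by (rule symmetric_kernel_graphon[OF W])
  let ?P = "\<Pi>\<^sub>M v\<in>{..<l}. unit_interval_measure"
  let ?f = "\<lambda>x. (\<Prod>i<l - 1. W (x i) (x (Suc i))) * W (x 0) (x (l - 1))"
  have eq: "hom_density (cycle_graph l) W = (\<integral>x. ?f x \<partial>?P)"
  proof -
    \<comment> \<open>For \<open>l \<ge> 3\<close> the closing edge is not a path edge, so it
      contributes a separate factor.\<close>
    have "(0, l - 1) \<notin> (\<lambda>i. (i, Suc i)) ` {..<l - 1}" using l by auto
    then have "(\<Prod>(u, v) | (u, v) \<in> parcs (cycle_graph l) \<and> u < v. W (x u) (x v)) = ?f x" for x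
      unfolding cycle_graph_edges[OF l]
      by (subst prod.insert) (auto simp: prod.reindex inj_on_def mult.commute)
    moreover have "pverts (cycle_graph l) = {..<l}" by (simp add: cycle_graph_def)
    ultimately show ?thesis unfolding hom_density_def by simp
  qed
  have range: "0 \<le> W (x i) (x j)" if "x \<in> space ?P" "i < l" "j < l" for x i j
    using that W by (auto simp: graphon_def space_PiM space_restrict_space PiE_iff)
  have W_meas: "(\<lambda>x. W (x i) (x j)) \<in> borel_measurable ?P" if "i < l" "j < l" for i j
  proof -
    have "(\<lambda>x. (x i, x j)) \<in> ?P \<rightarrow>\<^sub>M unit_interval_measure \<Otimes>\<^sub>M unit_interval_measure"
      using that by (intro measurable_Pair measurable_component_singleton) auto
    from measurable_compose[OF this, of "case_prod W" borel] W show ?thesis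
      by (simp add: graphon_def)
  qed
  have nonneg: "0 \<le> ?f x" if "x \<in> space ?P" for x
    using l by (intro mult_nonneg_nonneg prod_nonneg range[OF that] ballI) auto
  have "?f \<in> borel_measurable ?P"
    using l by (intro borel_measurable_times borel_measurable_prod W_meas) auto
  then have "hom_density (cycle_graph l) W = enn2real (\<integral>\<^sup>+x. ennreal (?f x) \<partial>?P)"
    unfolding eq using nonneg by (intro integral_eq_nn_integral) auto
  also have "(\<integral>\<^sup>+x. ennreal (?f x) \<partial>?P)
      = (\<integral>\<^sup>+x. (\<Prod>i<l - 1. ennreal (W (x i) (x (Suc i)))) * kpow 0 (x 0) (x (l - 1)) \<partial>?P)"
  proof (intro nn_integral_cong)
    fix x assume x: "x \<in> space ?P"
    have "(\<Prod>i<l - 1. ennreal (W (x i) (x (Suc i)))) = ennreal (\<Prod>i<l - 1. W (x i) (x (Suc i)))"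
      by (rule prod_ennreal) (auto intro!: range[OF x])
    then show "ennreal (?f x) = (\<Prod>i<l - 1. ennreal (W (x i) (x (Suc i)))) * kpow 0 (x 0) (x (l - 1))"
      using l by (subst ennreal_mult) (auto intro!: prod_nonneg range[OF x])
  qed
  also have "\<dots> = tr (l - 1)"
    using nn_integral_cycle[of "l - 1" 0] l by (simp add: Suc_diff_Suc)
  finally show ?thesis
    using tr_le_1[of "l - 1"] by (auto simp: ennreal_enn2real_if top_unique)
qed

section \<open>Two disjoint cliques, the witness for the lower bound\<close>

definition two_block :: "real \<Rightarrow> real \<Rightarrow> real" where
  "two_block x y = of_bool ((x < 1/2) = (y < 1/2))"

lemma graphon_two_block: "graphon two_block"
proof -
  have [measurable]: "(\<lambda>x. x) \<in> unit_interval_measure \<rightarrow>\<^sub>M borel"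
    by (rule measurable_restrict_space1) simp
  have "(\<lambda>(x, y). two_block x y)
      = (\<lambda>z. if (fst z < 1/2) = (snd z < 1/2) then 1 else 0)"
    by (auto simp: two_block_def)
  also have "\<dots> \<in> borel_measurable (unit_interval_measure \<Otimes>\<^sub>M unit_interval_measure)"
    by measurable
  finally show ?thesis by (auto simp: graphon_def two_block_def)
qed

lemma nn_integral_two_block:
  assumes "x \<in> {0..1}"
  shows "(\<integral>\<^sup>+z. ennreal (two_block x z) \<partial>unit_interval_measure) = ennreal (1/2)"
proof -
  define A where "A = (if x < 1/2 then {0..<1/2} else {1/2..1::real})"
  have "(\<integral>\<^sup>+z. ennreal (two_block x z) \<partial>unit_interval_measure)
      = (\<integral>\<^sup>+z. indicator A z \<partial>unit_interval_measure)"
    by (intro nn_integral_cong) (auto simp: two_block_def A_def space_restrict_space indicator_def)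
  also have "\<dots> = emeasure unit_interval_measure A"
    by (rule nn_integral_indicator) (auto simp: A_def sets_restrict_space_iff)
  also have "\<dots> = emeasure lborel A"
    by (rule emeasure_restrict_space) (auto simp: A_def)
  also have "\<dots> = ennreal (1/2)" by (simp add: A_def)
  finally show ?thesis .
qed

text \<open>The kernel composed with itself is half of itself, so \<open>kpow j\<close> is
  \<open>(1/2) ^ j\<close> times the kernel, which is 1 on the diagonal.\<close>

lemma hom_density_two_block:
  assumes "l \<ge> 3"
  shows "hom_density (cycle_graph l) two_block = (1/2) ^ (l - 1)"
proof -
  interpret symmetric_kernel unit_interval_measure "\<lambda>x y. ennreal (two_block x y)"
    by (rule symmetric_kernel_graphon[OF graphon_two_block])
  have space: "space unit_interval_measure = {0..1}" by (simp add: space_restrict_space)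
  have kpow: "kpow j x y = ennreal ((1/2) ^ j) * ennreal (two_block x y)" if "x \<in> {0..1}" "y \<in> {0..1}" for j x y
    using that
  proof (induction j arbitrary: y)
    case (Suc j)
    have [measurable]: "x \<in> space unit_interval_measure" using Suc.prems by (simp add: space)
    \<comment> \<open>Lying in the same block is an equivalence relation, so \<open>y\<close> can be
      compared with \<open>x\<close> instead of \<open>z\<close>.\<close>
    have "kpow (Suc j) x y = (\<integral>\<^sup>+z. ennreal ((1/2) ^ j) * ennreal (two_block x y) * ennreal (two_block x z)
        \<partial>unit_interval_measure)"
      unfolding kpow.simps using Suc
      by (intro nn_integral_cong) (auto simp: space two_block_def)
    also have "\<dots> = ennreal ((1/2) ^ j) * ennreal (two_block x y) * ennreal (1/2)"
      using Suc.prems(1) by (subst nn_integral_cmult) (simp_all add: nn_integral_two_block)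
    also have "\<dots> = ennreal ((1/2) ^ Suc j) * ennreal (two_block x y)"
    proof -
      have "ennreal ((1/2) ^ Suc j) = ennreal ((1/2) ^ j) * ennreal (1/2)"
        unfolding power_Suc2 by (rule ennreal_mult) auto
      then show ?thesis by (simp only: mult_ac)
    qed
    finally show ?case .
  qed simp
  have "tr (l - 1) = (\<integral>\<^sup>+x. ennreal ((1/2) ^ (l - 1)) \<partial>unit_interval_measure)"
    unfolding tr_def by (intro nn_integral_cong) (simp add: space kpow, simp add: two_block_def)
  also have "\<dots> = ennreal ((1/2) ^ (l - 1))" by (simp only: nn_integral_const emeasure_space_1 mult_1_right)
  finally show ?thesis
    using hom_density_cycle[OF graphon_two_block assms]
      hom_density_bounds(1)[OF pair_graph_cycle_graph[OF assms] graphon_two_block]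
    by simp
qed

section \<open>Bounds on the domination exponent\<close>

theorem theorem4p5:
  fixes n k :: nat
  assumes "n > 0" and "k > 0" and "2 * n \<ge> k" and "k \<ge> 3"
  shows "ennreal ((2 * real n - 1) / (real k - 1))
           \<le> domination_exponent (cycle_graph k) (cycle_graph (2 * n))
       \<and> domination_exponent (cycle_graph k) (cycle_graph (2 * n))
           \<le> ennreal ((2 * real n - 1 - 1 / (2 * real n - 1)) / (real k - 1 - 1 / (2 * real n - 1)))
       \<and> (2 * real n - 1 - 1 / (2 * real n - 1)) / (real k - 1 - 1 / (2 * real n - 1))
           < (2 * real n - 1) / (real k - 1) + 1 / (real k - 1)\<^sup>2"
proof (intro conjI)
  let ?m = "2 * real n - 1" and ?K = "real k - 1"
  have n: "n \<ge> 2" "2 * n \<ge> 3" using assms by auto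
  have K: "?K \<ge> 2" "?m \<ge> ?K" "?m \<ge> 3" using assms n by auto
  have mK: "?m * ?K > 1" using K mult_mono[of 3 ?m 2 ?K] by linarith
  \<comment> \<open>Clearing the inner fractions exposes the coefficients of
    \<open>ln_tr_le\<close>.\<close>
  have c: "(?m - 1 / ?m) / (?K - 1 / ?m) = (?m\<^sup>2 - 1) / (?m * ?K - 1)"
  proof -
    have "?m - 1 / ?m = (?m\<^sup>2 - 1) / ?m" "?K - 1 / ?m = (?m * ?K - 1) / ?m"
      using K by (simp_all add: field_simps power2_eq_square)
    then show ?thesis using K by simp
  qed
  \<comment> \<open>The exact excess over \<open>?m / ?K\<close>; comparing it with
    \<open>1 / ?K^2\<close> comes down to \<open>?K * (?K^2 - 1) > 0\<close>.\<close>
  have split: "(?m\<^sup>2 - 1) / (?m * ?K - 1) = ?m / ?K + (?m - ?K) / (?K * (?m * ?K - 1))"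
    using K mK by (simp add: divide_simps) (simp add: algebra_simps power2_eq_square)
  have "(?m - ?K) * ?K\<^sup>2 < 1 * (?K * (?m * ?K - 1))"
  proof -
    have "1 < ?K\<^sup>2" using K by (intro one_less_power) auto
    then have "0 < ?K * (?K\<^sup>2 - 1)" using K by simp
    also have "\<dots> = ?K * (?m * ?K - 1) - (?m - ?K) * ?K\<^sup>2"
      by (simp add: algebra_simps power2_eq_square)
    finally show ?thesis by simp
  qed
  moreover have "a / d < 1 / q" if "a * q < 1 * d" "0 < d" "0 < q" for a d q :: real
    using that by (simp add: field_simps)
  moreover have "0 < ?K * (?m * ?K - 1)" "0 < ?K\<^sup>2" using K mK by simp_all
  ultimately have "(?m - ?K) / (?K * (?m * ?K - 1)) < 1 / ?K\<^sup>2" by blast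
  then show "(?m - 1 / ?m) / (?K - 1 / ?m) < ?m / ?K + 1 / ?K\<^sup>2"
    unfolding c split by simp
  show "ennreal (?m / ?K) \<le> domination_exponent (cycle_graph k) (cycle_graph (2 * n))"
    unfolding domination_exponent_def
  proof (rule SUP_upper2)
    have "(1/2::real) ^ (k - 1) < 1" 
      using assms power_strict_decreasing[of 0 "k - 1" "1/2::real"] by simp
    then show "two_block \<in> {W. graphon W \<and> hom_density (cycle_graph k) W \<noteq> 0 \<and> hom_density (cycle_graph k) W \<noteq> 1}"
      using assms by (simp add: graphon_two_block hom_density_two_block)
    have "ln ((1/2::real) ^ (2 * n - 1)) / ln ((1/2) ^ (k - 1)) = ?m / ?K"
      using n assms by (simp add: ln_realpow of_nat_diff)
    then show "ennreal (?m / ?K) \<le> log_density_ratio (cycle_graph k) (cycle_graph (2 * n)) two_block"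
      using assms n by (simp add: log_density_ratio_def hom_density_two_block)
  qed
  show "domination_exponent (cycle_graph k) (cycle_graph (2 * n))
      \<le> ennreal ((?m - 1 / ?m) / (?K - 1 / ?m))"
    unfolding domination_exponent_def c
  proof (rule SUP_least)
    fix W assume "W \<in> {W. graphon W \<and> hom_density (cycle_graph k) W \<noteq> 0 \<and> hom_density (cycle_graph k) W \<noteq> 1}"
    then have W: "graphon W" and ne: "hom_density (cycle_graph k) W \<noteq> 0" "hom_density (cycle_graph k) W \<noteq> 1"
      by auto
    interpret symmetric_kernel unit_interval_measure "\<lambda>x y. ennreal (W x y)"
      by (rule symmetric_kernel_graphon[OF W])
    let ?t = "hom_density (cycle_graph k) W" and ?s = "hom_density (cycle_graph (2 * n)) W"
    have t: "ennreal ?t = tr (k - 1)" and s: "ennreal ?s = tr (2 * n - 1)"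
      using hom_density_cycle[OF W] assms n by auto
    have bounds: "0 \<le> ?t" "?t \<le> 1" "0 \<le> ?s"
      using hom_density_bounds[OF pair_graph_cycle_graph W] assms n by auto
    have nz: "tr (k - 1) \<noteq> 0" unfolding t[symmetric] using ne bounds by simp
    \<comment> \<open>Rules out the infinite value of the ratio.\<close>
    have s0: "?s \<noteq> 0" using ln_tr_le(1)[OF nz, of n, folded s] assms by auto
    have "real (4 * n) * (real n - 1) * ln ?t \<le> (2 * real n * (real k - 1) - real k) * ln ?s"
      using ln_tr_le(2)[OF nz, of n, folded s t] assms bounds by simp
    then have "(?m\<^sup>2 - 1) * ln ?t \<le> (?m * ?K - 1) * ln ?s"
      by (simp add: algebra_simps power2_eq_square)
    moreover have "ln ?t < 0" using bounds ne by simp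
    \<comment> \<open>Dividing by the negative \<open>ln ?t\<close> reverses the inequality.\<close>
    ultimately have "ln ?s / ln ?t \<le> (?m\<^sup>2 - 1) / (?m * ?K - 1)"
      using mK by (simp add: divide_simps mult.commute)
    then show "log_density_ratio (cycle_graph k) (cycle_graph (2 * n)) W \<le> ennreal ((?m\<^sup>2 - 1) / (?m * ?K - 1))"
      using s0 by (simp add: log_density_ratio_def ennreal_leI)
  qed
qed

end
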